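(* Let $r(\boldsymbol{x}) = p_{\mathrm{te}}(\boldsymbol{x})/p_{\mathrm{tr}}(\boldsymbol{x})$ be the importance and let $\mathcal{F} \subseteq \{f\colon \mathcal{X}\to\mathbb{R}\}$ be a given hypothesis set. Suppose that there is a constant $m\in\mathbb{R}$ such that $\ell(f(\boldsymbol{x}),y)\le m$ for every $f\in\mathcal{F}$ and every $(\boldsymbol{x},y)\in\mathcal{X}\times\mathcal{Y}$. Then, under covariate shift, for any $f\in\mathcal{F}$ and any measurable function $g\colon\mathcal{X}\to\mathbb{R}$, $$\frac12 R^2(f) \le J(f,g) := \left(\mathbb{E}_{(\boldsymbol{x},y)\sim p_{\mathrm{tr}}(\boldsymbol{x},y)}\left[\ell(f(\boldsymbol{x}),y)\,g(\boldsymbol{x})\right]\right)^2 + m^2\,\mathbb{E}_{\boldsymbol{x}\sim p_{\mathrm{tr}}(\boldsymbol{x})}\left[\left(g(\boldsymbol{x})-r(\boldsymbol{x})\right)^2\right].$$ Furthermore, if $g$ is non-negative and $\ell_{\mathrm{UB}}\colon\mathbb{R}\times\mathcal{Y}\to\mathbb{R}_+$ bounds $\ell$ from above (i.e. $\ell\le\ell_{\mathrm{UB}}$ pointwise), then $$J(f,g)\le J_{\mathrm{UB}}(f,g) := \left(\mathbb{E}_{(\boldsymbol{x},y)\sim p_{\mathrm{tr}}(\boldsymbol{x},y)}\left[\ell_{\mathrm{UB}}(f(\boldsymbol{x}),y)\,g(\boldsymbol{x})\right]\right)^2 + m^2\,\mathbb{E}_{\boldsymbol{x}\sim p_{\mathr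m{tr}}(\boldsymbol{x})}\left[\left(g(\boldsymbol{x})-r(\boldsymbol{x})\right)^2\right].$$
   Context: Setting. $\mathcal{X}\subset\mathbb{R}^d$ is the input space ($d$ a positive integer), and the output space is $\mathcal{Y}\subset\mathbb{R}$ (regression) or $\mathcal{Y}=\{-1,+1\}$ (binary classification). The training distribution has density $p_{\mathrm{tr}}(\boldsymbol{x},y)=p_{\mathrm{tr}}(\boldsymbol{x})p_{\mathrm{tr}}(y|\boldsymbol{x})$ and the test distribution has density $p_{\mathrm{te}}(\boldsymbol{x},y)=p_{\mathrm{te}}(\boldsymbol{x})p_{\mathrm{te}}(y|\boldsymbol{x})$ on $\mathcal{X}\times\mathcal{Y}$. Covariate shift means: $p_{\mathrm{tr}}(\boldsymbol{x})\ne p_{\mathrm{te}}(\boldsymbol{x})$ in general, $\operatorname{supp}(p_{\mathrm{tr}})=\operatorname{supp}(p_{\mathrm{te}})$ for the input densities (support understood as the set where the density is positive, so that $r$ is well defined), and $p_{\mathrm{tr}}(y|\boldsymbol{x})=p_{\mathrm{te}}(y|\boldsymbol{x})$. The loss is a function $\ell\colon\mathbb{R}\times\mathcal{Y}\to\mathbb{R}_+$ (non-negative), and the test risk of $f\colon\mathcal{X}\to\mathbb{R}$ is $R(f):=\mathbb{E}_{(\boldsymbol{x},y)\sim p_{\mathrm{te}}(\boldsymbol{x},y)}[\ell(f(\boldsymbol{x}),y)]$. $R^2(f)$ denotes $(R(f))^2$. All losses and hypotheses are measurable. The right-hand sides take values in $[0,+\infty]$ and are read as $+\infty$ whenever $\mathbb{E}_{\boldsymbol{x}\sim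 p_{\mathrm{tr}}}[(g-r)^2]=+\infty$. *)

theory Defs
  imports "HOL-Probability.Probability"
begin

definition prob_density :: "'a measure \<Rightarrow> ('a \<Rightarrow> real) \<Rightarrow> bool" where
  "prob_density M p \<longleftrightarrow>
     p \<in> borel_measurable M \<and> (\<forall>x\<in>space M. 0 \<le> p x) \<and> (\<integral>\<^sup>+x. ennreal (p x) \<partial>M) = 1"

text \<open>
  A conditional density is written \<open>c x y\<close> for \<open>p(y | x)\<close>. It is only required to be
  a probability density at the points where the input density is positive; elsewhere it does
  not influence the joint density \<open>p(x) p(y | x)\<close>.
\<close>

definition cond_density ::
  "'a measure \<Rightarrow> 'b measure \<Rightarrow> ('a \<Rightarrow> real) \<Rightarrow> ('a \<Rightarrow> 'b \<Rightarrow> real) \<Rightarrow> bool" where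
  "cond_density \<mu> \<nu> p c \<longleftrightarrow>
     (\<lambda>(x, y). c x y) \<in> borel_measurable (\<mu> \<Otimes>\<^sub>M \<nu>) \<and>
     (\<forall>x\<in>space \<mu>. 0 < p x \<longrightarrow> prob_density \<nu> (c x))"

definition input_law :: "'a measure \<Rightarrow> ('a \<Rightarrow> real) \<Rightarrow> 'a measure" where
  "input_law \<mu> p = density \<mu> (\<lambda>x. ennreal (p x))"

definition joint_law ::
  "'a measure \<Rightarrow> 'b measure \<Rightarrow> ('a \<Rightarrow> real) \<Rightarrow> ('a \<Rightarrow> 'b \<Rightarrow> real) \<Rightarrow> ('a \<times> 'b) measure" where
  "joint_law \<mu> \<nu> p c = density (\<mu> \<Otimes>\<^sub>M \<nu>) (\<lambda>(x, y). ennreal (p x * c x y))"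

definition pos_set :: "'a set \<Rightarrow> ('a \<Rightarrow> real) \<Rightarrow> 'a set" where
  "pos_set X p = {x\<in>X. 0 < p x}"

text \<open>
  Conditional densities are compared on the common support of the input densities, the only
  place where they are determined. The input densities may or may not differ.
\<close>

definition covariate_shift ::
  "'a set \<Rightarrow> 'b set \<Rightarrow> ('a \<Rightarrow> real) \<Rightarrow> ('a \<Rightarrow> 'b \<Rightarrow> real) \<Rightarrow>
     ('a \<Rightarrow> real) \<Rightarrow> ('a \<Rightarrow> 'b \<Rightarrow> real) \<Rightarrow> bool" where
  "covariate_shift X Y p_tr c_tr p_te c_te \<longleftrightarrow>
     pos_set X p_tr = pos_set X p_te \<and>
     (\<forall>x\<in>pos_set X p_tr. \<forall>y\<in>Y. c_tr x y = c_te x y)"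

definition importance :: "('a \<Rightarrow> real) \<Rightarrow> ('a \<Rightarrow> real) \<Rightarrow> 'a \<Rightarrow> real" where
  "importance p_tr p_te x = p_te x / p_tr x"

text \<open>
  Extended-real expectation, positive part minus negative part. Unlike the Bochner integral,
  it is \<open>\<infinity>\<close> (and not 0) for a non-negative integrand that is not integrable, which
  can happen for an unbounded surrogate loss.
\<close>

definition ext_expectation :: "'a measure \<Rightarrow> ('a \<Rightarrow> real) \<Rightarrow> ereal" where
  "ext_expectation M h =
     enn2ereal (\<integral>\<^sup>+x. ennreal (h x) \<partial>M) - enn2ereal (\<integral>\<^sup>+x. ennreal (- h x) \<partial>M)"

definition test_risk ::
  "'a measure \<Rightarrow> 'b measure \<Rightarrow> ('a \<Rightarrow> real) \<Rightarrow> ('a \<Rightarrow> 'b \<Rightarrow> real) \<Rightarrow>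
     (real \<Rightarrow> 'b \<Rightarrow> real) \<Rightarrow> ('a \<Rightarrow> real) \<Rightarrow> real" where
  "test_risk \<mu> \<nu> p_te c_te loss f =
     (\<integral>(x, y). loss (f x) y \<partial>(joint_law \<mu> \<nu> p_te c_te))"

text \<open>
  The case distinction fixes the value \<open>\<infinity>\<close> whenever the squared deviation has infinite
  expectation, including for \<open>m = 0\<close> (where \<open>0 * \<infinity> = 0\<close> in \<^typ>\<open>ereal\<close>). If that
  expectation is finite, the first expectation is finite for every bounded loss.
\<close>

definition J_bound ::
  "'a measure \<Rightarrow> 'b measure \<Rightarrow> ('a \<Rightarrow> real) \<Rightarrow> ('a \<Rightarrow> 'b \<Rightarrow> real) \<Rightarrow> ('a \<Rightarrow> real) \<Rightarrow>
     real \<Rightarrow> (real \<Rightarrow> 'b \<Rightarrow> real) \<Rightarrow> ('a \<Rightarrow> real) \<Rightarrow> ('a \<Rightarrow> real) \<Rightarrow> ereal" where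
  "J_bound \<mu> \<nu> p_tr c_tr p_te m loss f g =
     (let D = ext_expectation (input_law \<mu> p_tr) (\<lambda>x. (g x - importance p_tr p_te x)\<^sup>2)
      in if D = \<infinity> then \<infinity>
         else (ext_expectation (joint_law \<mu> \<nu> p_tr c_tr) (\<lambda>(x, y). loss (f x) y * g x))\<^sup>2
              + ereal (m\<^sup>2) * D)"

text \<open>A loss is a measurable function from \<open>\<real> \<times> Y\<close> to the non-negative reals.\<close>

definition loss_fun :: "real set \<Rightarrow> (real \<Rightarrow> real \<Rightarrow> real) \<Rightarrow> bool" where
  "loss_fun Y loss \<longleftrightarrow>
     (\<lambda>(t, y). loss t y) \<in> borel_measurable (borel \<Otimes>\<^sub>M restrict_space borel Y) \<and>
     (\<forall>t. \<forall>y\<in>Y. 0 \<le> loss t y)"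

end

theory Submission
  imports Defs
begin

text \<open>
  Under covariate shift the test law has density \<open>r(x)\<close> with respect to the training law,
  so \<open>R(f) = E[\<ell> r] = E[\<ell> g] + E[\<ell> (r - g)]\<close> with expectations over the training law. Then
  \<open>(a + b)\<^sup>2 \<le> 2 a\<^sup>2 + 2 b\<^sup>2\<close>, and \<open>(E[\<ell> (r - g)])\<^sup>2 \<le> E[\<ell>\<^sup>2 (r - g)\<^sup>2] \<le> m\<^sup>2 E[(g - r)\<^sup>2]\<close>.
\<close>

section \<open>Extended expectations\<close>

lemma ext_expectation_nonneg:
  assumes "\<And>x. x \<in> space M \<Longrightarrow> 0 \<le> h x"
  shows "ext_expectation M h = enn2ereal (\<integral>\<^sup>+x. ennreal (h x) \<partial>M)"
proof -
  have "(\<integral>\<^sup>+x. ennreal (- h x) \<partial>M) = (\<integral>\<^sup>+x. 0 \<partial>M)"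
    by (intro nn_integral_cong) (simp add: assms ennreal_neg)
  then show ?thesis
    by (simp add: ext_expectation_def zero_ennreal.rep_eq)
qed

text \<open>Integrability makes the positive and the negative part finite, so the subtraction in
  \<open>ereal\<close> is ordinary real subtraction and no \<open>\<infinity> - \<infinity>\<close>
  can arise.\<close>

lemma ext_expectation_eq_integral:
  assumes "integrable M h"
  shows "ext_expectation M h = ereal (\<integral>x. h x \<partial>M)"
proof -
  have pos: "(\<integral>\<^sup>+x. ennreal (h x) \<partial>M) < top" and neg: "(\<integral>\<^sup>+x. ennreal (- h x) \<partial>M) < top"
    using assms by (auto simp: real_integrable_def top.not_eq_extremum)
  have "enn2ereal a - enn2ereal b = ereal (enn2real a - enn2real b)" if "a < top" "b < top" for a b
    using that by (cases a; cases b) (auto simp: enn2ereal_ennreal)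
  then show ?thesis
    using pos neg by (simp add: ext_expectation_def real_lebesgue_integral_def[OF assms])
qed

section \<open>Joint laws, their input marginals and the change of measure\<close>

lemma sets_joint_law [simp, measurable_cong]: "sets (joint_law \<mu> \<nu> p c) = sets (\<mu> \<Otimes>\<^sub>M \<nu>)"
  by (simp add: joint_law_def)

lemma space_joint_law [simp]: "space (joint_law \<mu> \<nu> p c) = space \<mu> \<times> space \<nu>"
  by (simp add: joint_law_def space_pair_measure)

lemma measurable_joint_density:
  assumes "prob_density \<mu> p" "cond_density \<mu> \<nu> p c"
  shows "(\<lambda>(x, y). ennreal (p x * c x y)) \<in> borel_measurable (\<mu> \<Otimes>\<^sub>M \<nu>)"
proof -
  have [measurable]: "p \<in> borel_measurable \<mu>"
    "(\<lambda>(x, y). c x y) \<in> borel_measurable (\<mu> \<Otimes>\<^sub>M \<nu>)"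
    using assms by (auto simp: prob_density_def cond_density_def)
  show ?thesis by measurable
qed

text \<open>By Tonelli the integral over \<open>y\<close> can be done first. Where
  \<open>p x > 0\<close> the section \<open>c x\<close> has integral 1; where \<open>p x = 0\<close>
  the section is unconstrained, but the factor \<open>p x\<close> makes both sides 0. This lets
  quantities over the input law be computed on the joint space.\<close>

lemma nn_integral_joint_law_fst:
  assumes "sigma_finite_measure \<nu>" "prob_density \<mu> p" "cond_density \<mu> \<nu> p c"
    and u [measurable]: "u \<in> borel_measurable \<mu>"
  shows "(\<integral>\<^sup>+z. u (fst z) \<partial>joint_law \<mu> \<nu> p c) = (\<integral>\<^sup>+x. u x \<partial>input_law \<mu> p)"
proof -
  note [measurable] = measurable_joint_density[OF assms(2,3)]
  have [measurable]: "p \<in> borel_measurable \<mu>"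
    and p: "\<And>x. x \<in> space \<mu> \<Longrightarrow> 0 \<le> p x"
    using assms(2) by (auto simp: prob_density_def)
  have "(\<integral>\<^sup>+z. u (fst z) \<partial>joint_law \<mu> \<nu> p c) =
      (\<integral>\<^sup>+z. (case z of (x, y) \<Rightarrow> ennreal (p x * c x y)) * u (fst z) \<partial>(\<mu> \<Otimes>\<^sub>M \<nu>))"
    unfolding joint_law_def by (rule nn_integral_density) measurable
  also have "\<dots> = (\<integral>\<^sup>+x. \<integral>\<^sup>+y. ennreal (p x * c x y) * u x \<partial>\<nu> \<partial>\<mu>)"
    using sigma_finite_measure.nn_integral_fst[OF assms(1), of
        "\<lambda>z. (case z of (x, y) \<Rightarrow> ennreal (p x * c x y)) * u (fst z)" \<mu>]
      borel_measurable_times_ennreal[OF measurable_joint_density[OF assms(2,3)], of "\<lambda>z. u (fst z)"]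
    by simp
  also have "\<dots> = (\<integral>\<^sup>+x. ennreal (p x) * u x \<partial>\<mu>)"
  proof (rule nn_integral_cong)
    fix x assume x: "x \<in> space \<mu>"
    show "(\<integral>\<^sup>+y. ennreal (p x * c x y) * u x \<partial>\<nu>) = ennreal (p x) * u x"
    proof (cases "p x = 0")
      case False
      then have c: "prob_density \<nu> (c x)"
        using assms(3) p[OF x] x by (auto simp: cond_density_def)
      then have [measurable]: "c x \<in> borel_measurable \<nu>"
        by (simp add: prob_density_def)
      have "(\<integral>\<^sup>+y. ennreal (p x * c x y) * u x \<partial>\<nu>) =
          (\<integral>\<^sup>+y. (ennreal (p x) * u x) * ennreal (c x y) \<partial>\<nu>)"
        using p[OF x] c
        by (intro nn_integral_cong) (auto simp: ennreal_mult prob_density_def ac_simps)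
      also have "\<dots> = ennreal (p x) * u x"
        using c by (simp add: nn_integral_cmult prob_density_def)
      finally show ?thesis .
    qed simp
  qed
  also have "\<dots> = (\<integral>\<^sup>+x. u x \<partial>input_law \<mu> p)"
    unfolding input_law_def by (rule nn_integral_density[symmetric]) measurable
  finally show ?thesis .
qed

text \<open>The constant 1 has the same integral under the joint law as under its input marginal,
  which has mass 1.\<close>

lemma prob_space_joint_law:
  assumes "sigma_finite_measure \<nu>" "prob_density \<mu> p" "cond_density \<mu> \<nu> p c"
  shows "prob_space (joint_law \<mu> \<nu> p c)"
proof
  have [measurable]: "p \<in> borel_measurable \<mu>"
    using assms(2) by (simp add: prob_density_def)
  have "emeasure (joint_law \<mu> \<nu> p c) (space (joint_law \<mu> \<nu> p c)) = (\<integral>\<^sup>+z. 1 \<partial>joint_law \<mu> \<nu> p c)"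
    by simp
  also have "\<dots> = (\<integral>\<^sup>+x. 1 \<partial>input_law \<mu> p)"
    using nn_integral_joint_law_fst[OF assms, of "\<lambda>_. 1"] by simp
  also have "\<dots> = (\<integral>\<^sup>+x. ennreal (p x) * 1 \<partial>\<mu>)"
    unfolding input_law_def by (rule nn_integral_density) measurable
  also have "\<dots> = 1"
    using assms(2) by (simp add: prob_density_def)
  finally show "emeasure (joint_law \<mu> \<nu> p c) (space (joint_law \<mu> \<nu> p c)) = 1" .
qed

text \<open>The two densities agree at every point of the space: on the common support
  \<open>p_tr x\<close> cancels, and off it both sides vanish.\<close>

lemma joint_law_covariate_shift:
  assumes "prob_density \<mu> p_tr" "cond_density \<mu> \<nu> p_tr c_tr"
    and "prob_density \<mu> p_te"
    and "covariate_shift (space \<mu>) (space \<nu>) p_tr c_tr p_te c_te"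
  shows "joint_law \<mu> \<nu> p_te c_te =
    density (joint_law \<mu> \<nu> p_tr c_tr) (\<lambda>z. ennreal (importance p_tr p_te (fst z)))"
proof -
  note [measurable] = measurable_joint_density[OF assms(1,2)]
  have [measurable]: "p_tr \<in> borel_measurable \<mu>" "p_te \<in> borel_measurable \<mu>"
    using assms(1,3) by (auto simp: prob_density_def)
  have eq: "ennreal (p_te x * c_te x y) =
      ennreal (p_tr x * c_tr x y) * ennreal (importance p_tr p_te x)"
    if x: "x \<in> space \<mu>" and y: "y \<in> space \<nu>" for x y
  proof (cases "p_tr x = 0")
    case True
    then have "x \<notin> pos_set (space \<mu>) p_tr"
      by (simp add: pos_set_def)
    then have "x \<notin> pos_set (space \<mu>) p_te"
      using assms(4) by (simp add: covariate_shift_def)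
    then have "p_te x = 0"
      using x assms(3) by (force simp: pos_set_def prob_density_def)
    with True show ?thesis by simp
  next
    case False
    then have pos: "0 < p_tr x" and te: "0 \<le> p_te x"
      using x assms(1,3) by (auto simp: prob_density_def less_le)
    then have "c_tr x y = c_te x y" and "0 \<le> c_tr x y"
      using x y assms(2,4)
      by (auto simp: covariate_shift_def pos_set_def cond_density_def prob_density_def)
    with pos te show ?thesis
      by (simp add: importance_def ennreal_mult[symmetric])
  qed
  \<comment> \<open>\<open>c_te\<close> is not assumed measurable in this lemma, so the densities
    are compared inside the integrals that define the two measures, where pointwise agreement
    suffices.\<close>
  have "joint_law \<mu> \<nu> p_te c_te = density (\<mu> \<Otimes>\<^sub>M \<nu>)
      (\<lambda>z. (case z of (x, y) \<Rightarrow> ennreal (p_tr x * c_tr x y)) * ennreal (importance p_tr p_te (fst z)))"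
    unfolding joint_law_def density_def
    by (intro arg_cong[where f = "measure_of _ _"] ext nn_integral_cong)
      (auto simp: space_pair_measure eq)
  also have "\<dots> = density (joint_law \<mu> \<nu> p_tr c_tr) (\<lambda>z. ennreal (importance p_tr p_te (fst z)))"
    unfolding joint_law_def
    by (rule density_density_eq[symmetric]) (unfold importance_def, measurable)
  finally show ?thesis .
qed

section \<open>The inequality on a single probability space\<close>

lemma integrable_bounded_mult:
  fixes h k :: "'a \<Rightarrow> real"
  assumes "h \<in> borel_measurable M" "integrable M k"
    and "\<And>x. x \<in> space M \<Longrightarrow> \<bar>h x\<bar> \<le> m"
  shows "integrable M (\<lambda>x. h x * k x)"
proof (rule Bochner_Integration.integrable_bound)
  show "integrable M (\<lambda>x. m * k x)"
    using assms(2) by simp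
  show "(\<lambda>x. h x * k x) \<in> borel_measurable M"
    using assms(1,2) by measurable
  show "AE x in M. norm (h x * k x) \<le> norm (m * k x)"
  proof (rule AE_I2)
    fix x assume "x \<in> space M"
    then have "\<bar>h x\<bar> \<le> \<bar>m\<bar>"
      using assms(3)[of x] by linarith
    then show "norm (h x * k x) \<le> norm (m * k x)"
      by (simp add: abs_mult mult_right_mono)
  qed
qed

text \<open>All further integrability comes from that of \<open>r\<close> and of the squared
  deviation, since \<open>h\<close> is bounded and the measure finite. The first claim is what makes
  the first expectation in \<open>J_bound\<close> a real number.\<close>

lemma (in prob_space) weighted_expectation_bound:
  fixes h g r :: "'a \<Rightarrow> real"
  assumes [measurable]: "h \<in> borel_measurable M" "g \<in> borel_measurable M"
    and bound: "\<And>x. x \<in> space M \<Longrightarrow> \<bar>h x\<bar> \<le> m"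
    and r: "integrable M r" and sq: "integrable M (\<lambda>x. (g x - r x)\<^sup>2)"
  shows "integrable M (\<lambda>x. h x * g x)"
    and "1 / 2 * (expectation (\<lambda>x. h x * r x))\<^sup>2
      \<le> (expectation (\<lambda>x. h x * g x))\<^sup>2 + m\<^sup>2 * expectation (\<lambda>x. (g x - r x)\<^sup>2)"
proof -
  have [measurable]: "r \<in> borel_measurable M"
    using r by simp
  \<comment> \<open>On a probability space square integrability implies integrability; adding
    \<open>r\<close> back then gives integrability of \<open>g\<close>.\<close>
  have d: "integrable M (\<lambda>x. g x - r x)"
    by (rule square_integrable_imp_integrable[OF _ sq]) measurable
  have g: "integrable M g"
    using Bochner_Integration.integrable_add[OF d r] by simp
  show hg: "integrable M (\<lambda>x. h x * g x)"
    by (rule integrable_bounded_mult) (use g bound in auto)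
  have hr: "integrable M (\<lambda>x. h x * r x)"
    by (rule integrable_bounded_mult) (use r bound in auto)
  have hd: "integrable M (\<lambda>x. h x * (g x - r x))"
    by (rule integrable_bounded_mult) (use d bound in auto)
  \<comment> \<open>The bound on the absolute value matters here: an upper bound on \<open>h\<close>
    alone would not control its square.\<close>
  have h2: "(h x)\<^sup>2 \<le> m\<^sup>2" if "x \<in> space M" for x
    using power_mono[OF bound[OF that], of 2] by simp
  have hd2: "integrable M (\<lambda>x. (h x * (g x - r x))\<^sup>2)"
    unfolding power_mult_distrib by (rule integrable_bounded_mult) (use sq h2 in auto)
  define a where "a = expectation (\<lambda>x. h x * g x)"
  define b where "b = expectation (\<lambda>x. h x * (g x - r x))"
  have "expectation (\<lambda>x. h x * r x) = a - b"
    using hg hr hd by (simp add: a_def b_def right_diff_distrib)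
  \<comment> \<open>Jensen's inequality for the square, obtained as nonnegativity of the variance of
    \<open>h * (g - r)\<close>.\<close>
  moreover have "0 \<le> expectation (\<lambda>x. (h x * (g x - r x))\<^sup>2) - b\<^sup>2"
    using variance_positive[of "\<lambda>x. h x * (g x - r x)"] variance_eq[OF hd hd2]
    by (simp add: b_def)
  moreover have "expectation (\<lambda>x. (h x * (g x - r x))\<^sup>2) \<le> expectation (\<lambda>x. m\<^sup>2 * (g x - r x)\<^sup>2)"
    by (rule integral_mono[OF hd2])
      (use sq in \<open>auto simp: power_mult_distrib intro!: mult_right_mono h2\<close>)
  \<comment> \<open>The gap between the two sides is half of \<open>(a + b)\<^sup>2\<close>.\<close>
  moreover have "1 / 2 * (a - b)\<^sup>2 \<le> a\<^sup>2 + b\<^sup>2"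
    using zero_le_power2[of "a + b"] by (simp add: power2_sum power2_diff)
  ultimately show "1 / 2 * (expectation (\<lambda>x. h x * r x))\<^sup>2
      \<le> (expectation (\<lambda>x. h x * g x))\<^sup>2 + m\<^sup>2 * expectation (\<lambda>x. (g x - r x)\<^sup>2)"
    by (simp add: a_def)
qed

section \<open>Test risk, the bound and surrogate losses\<close>

text \<open>\<open>loss_fun\<close> refers to the restricted Borel space on \<open>Y\<close>, with
  which \<open>\<nu>\<close> shares its sets; after that transfer the loss is composed with the
  measurable map from \<open>(x, y)\<close> to \<open>(f x, y)\<close>.\<close>

lemma measurable_loss_comp:
  assumes "loss_fun Y loss" "sets \<nu> = sets (restrict_space borel Y)"
    and [measurable]: "f \<in> borel_measurable \<mu>"
  shows "(\<lambda>(x, y). loss (f x) y) \<in> borel_measurable (\<mu> \<Otimes>\<^sub>M \<nu>)"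
proof -
  note [measurable_cong] = assms(2)
  have [measurable]: "(\<lambda>(t, y). loss t y) \<in> borel_measurable (borel \<Otimes>\<^sub>M \<nu>)"
    using assms(1)
    by (simp add: loss_fun_def measurable_cong_sets[OF sets_pair_measure_cong[OF refl assms(2)] refl])
  show ?thesis by measurable
qed

text \<open>Everything is carried to the training joint law, with functions of \<open>x\<close> read
  as functions on pairs through \<open>fst\<close>, so that
  \<open>weighted_expectation_bound\<close> applies.\<close>

lemma half_test_risk_square_le_J_bound:
  fixes \<mu> :: "'a measure" and \<nu> :: "'b measure"
  assumes \<nu>: "sigma_finite_measure \<nu>"
    and tr: "prob_density \<mu> p_tr" "cond_density \<mu> \<nu> p_tr c_tr"
    and te: "prob_density \<mu> p_te" "cond_density \<mu> \<nu> p_te c_te"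
    and shift: "covariate_shift (space \<mu>) (space \<nu>) p_tr c_tr p_te c_te"
    and [measurable]: "(\<lambda>(x, y). loss (f x) y) \<in> borel_measurable (\<mu> \<Otimes>\<^sub>M \<nu>)"
      "g \<in> borel_measurable \<mu>"
    and bound: "\<And>x y. x \<in> space \<mu> \<Longrightarrow> y \<in> space \<nu> \<Longrightarrow> \<bar>loss (f x) y\<bar> \<le> m"
  shows "ereal (1 / 2 * (test_risk \<mu> \<nu> p_te c_te loss f)\<^sup>2)
    \<le> J_bound \<mu> \<nu> p_tr c_tr p_te m loss f g"
proof -
  define D where "D = ext_expectation (input_law \<mu> p_tr) (\<lambda>x. (g x - importance p_tr p_te x)\<^sup>2)"
  define Q where "Q = joint_law \<mu> \<nu> p_tr c_tr"
  define h where "h = (\<lambda>(x, y). loss (f x) y)"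
  define r where "r = (\<lambda>z :: 'a \<times> 'b. importance p_tr p_te (fst z))"
  \<comment> \<open>An infinite squared deviation makes the right-hand side infinite by definition;
    a finite one supplies the square integrability.\<close>
  show ?thesis
  proof (cases "D = \<infinity>")
    case True
    then show ?thesis by (simp add: J_bound_def D_def)
  next
    case False
    interpret prob_space Q
      unfolding Q_def by (rule prob_space_joint_law[OF \<nu> tr])
    have [measurable]: "p_tr \<in> borel_measurable \<mu>" "p_te \<in> borel_measurable \<mu>"
      using tr(1) te(1) by (auto simp: prob_density_def)
    have [measurable]: "importance p_tr p_te \<in> borel_measurable \<mu>"
      unfolding importance_def by measurable
    have h [measurable]: "h \<in> borel_measurable Q"
      unfolding h_def Q_def by measurable
    have g [measurable]: "(\<lambda>z. g (fst z)) \<in> borel_measurable Q"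
      unfolding Q_def by measurable
    have r [measurable]: "r \<in> borel_measurable Q"
      unfolding Q_def r_def by measurable
    have r_nonneg: "0 \<le> r z" if "z \<in> space Q" for z
      using that tr(1) te(1) by (auto simp: Q_def r_def importance_def prob_density_def)
    have shift_eq: "joint_law \<mu> \<nu> p_te c_te = density Q r"
      unfolding Q_def r_def by (rule joint_law_covariate_shift[OF tr te(1) shift])
    \<comment> \<open>The total mass 1 of the test law is the integral of \<open>r\<close> over
      \<open>Q\<close>, whence \<open>r\<close> is integrable.\<close>
    interpret te: prob_space "density Q r"
      using prob_space_joint_law[OF \<nu> te] by (simp only: shift_eq)
    have "(\<integral>\<^sup>+z. ennreal (r z) \<partial>Q) = 1"
      using te.emeasure_space_1 by (simp add: emeasure_density cong: nn_integral_cong)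
    then have int_r: "integrable Q r"
      by (intro integrableI_nonneg) (auto simp: r_nonneg)
    \<comment> \<open>The deviation is defined over the input law; the marginal identity moves it to
      \<open>Q\<close>.\<close>
    have D_nn: "D = enn2ereal (\<integral>\<^sup>+z. ennreal ((g (fst z) - r z)\<^sup>2) \<partial>Q)"
      using nn_integral_joint_law_fst[OF \<nu> tr, of "\<lambda>x. ennreal ((g x - importance p_tr p_te x)\<^sup>2)"]
      by (simp add: D_def ext_expectation_nonneg Q_def r_def)
    have sq: "integrable Q (\<lambda>z. (g (fst z) - r z)\<^sup>2)"
    proof (rule integrableI_nonneg)
      show "(\<integral>\<^sup>+z. ennreal ((g (fst z) - r z)\<^sup>2) \<partial>Q) < \<infinity>"
        using False D_nn by (auto simp: less_top[symmetric])
    qed auto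
    have D: "D = ereal (expectation (\<lambda>z. (g (fst z) - r z)\<^sup>2))"
      unfolding D_nn using sq by (simp add: nn_integral_eq_integral enn2ereal_ennreal)
    have h_bound: "\<bar>h z\<bar> \<le> m" if "z \<in> space Q" for z
      using that bound by (auto simp: Q_def h_def)
    have risk: "test_risk \<mu> \<nu> p_te c_te loss f = expectation (\<lambda>z. h z * r z)"
      unfolding test_risk_def shift_eq h_def[symmetric]
      by (subst integral_real_density) (auto simp: r_nonneg mult.commute)
    \<comment> \<open>Since \<open>g\<close> may change sign, it is integrability that allows the
      extended expectation to be replaced by the real one.\<close>
    have "ext_expectation Q (\<lambda>(x, y). loss (f x) y * g x) = ext_expectation Q (\<lambda>z. h z * g (fst z))"
      by (simp add: h_def case_prod_beta')
    also have "\<dots> = ereal (expectation (\<lambda>z. h z * g (fst z)))"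
      by (intro ext_expectation_eq_integral weighted_expectation_bound(1)[OF h g h_bound int_r sq])
    finally have A: "ext_expectation (joint_law \<mu> \<nu> p_tr c_tr) (\<lambda>(x, y). loss (f x) y * g x) =
        ereal (expectation (\<lambda>z. h z * g (fst z)))"
      by (simp only: Q_def)
    show ?thesis
      using weighted_expectation_bound(2)[OF h g h_bound int_r sq]
      unfolding J_bound_def D_def[symmetric] D A risk by simp
  qed
qed

text \<open>The comparison runs in \<open>[0, \<infinity>]\<close>, because the expectation of the
  larger loss may be infinite. Nonnegativity of \<open>g\<close> preserves the order under
  multiplication and turns both extended expectations into nonnegative integrals. The deviation term
  is common to both bounds; if it is infinite, both equal \<open>\<infinity>\<close>.\<close>

lemma J_bound_mono:
  assumes "\<And>x. x \<in> space \<mu> \<Longrightarrow> 0 \<le> g x"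
    and "\<And>t y. y \<in> space \<nu> \<Longrightarrow> 0 \<le> loss t y"
    and "\<And>t y. y \<in> space \<nu> \<Longrightarrow> loss t y \<le> loss' t y"
  shows "J_bound \<mu> \<nu> p_tr c_tr p_te m loss f g \<le> J_bound \<mu> \<nu> p_tr c_tr p_te m loss' f g"
proof -
  let ?Q = "joint_law \<mu> \<nu> p_tr c_tr"
  let ?E = "\<lambda>l. ext_expectation ?Q (\<lambda>(x, y). l (f x) y * g x)"
  have nonneg': "0 \<le> loss' t y" if "y \<in> space \<nu>" for t y
    using assms(2,3)[OF that, of t] by linarith
  have E: "?E l = enn2ereal (\<integral>\<^sup>+z. ennreal (case z of (x, y) \<Rightarrow> l (f x) y * g x) \<partial>?Q)"
    if "\<And>t y. y \<in> space \<nu> \<Longrightarrow> 0 \<le> l t y" for l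
    by (rule ext_expectation_nonneg) (auto simp: assms(1) that)
  have "(\<integral>\<^sup>+z. ennreal (case z of (x, y) \<Rightarrow> loss (f x) y * g x) \<partial>?Q)
      \<le> (\<integral>\<^sup>+z. ennreal (case z of (x, y) \<Rightarrow> loss' (f x) y * g x) \<partial>?Q)"
    by (intro nn_integral_mono ennreal_leI) (auto intro!: mult_right_mono assms)
  then have le: "?E loss \<le> ?E loss'"
    using E[of loss] E[of loss'] assms(2) nonneg' by (simp add: less_eq_ennreal.rep_eq)
  \<comment> \<open>Squaring preserves the order only between nonnegative values.\<close>
  have "0 \<le> ?E loss"
    using E[of loss] assms(2) by simp
  with le have "(?E loss)\<^sup>2 \<le> (?E loss')\<^sup>2"
    by (simp add: power2_eq_square ereal_mult_mono)
  then show ?thesis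
    by (auto simp: J_bound_def Let_def intro: add_right_mono)
qed

theorem theorem1:
  fixes X :: "(real ^ 'd) set" and Y :: "real set"
    and \<mu> :: "(real ^ 'd) measure" and \<nu> :: "real measure"
    and p_tr p_te :: "real ^ 'd \<Rightarrow> real"
    and c_tr c_te :: "real ^ 'd \<Rightarrow> real \<Rightarrow> real"
    and loss :: "real \<Rightarrow> real \<Rightarrow> real"
    and F :: "(real ^ 'd \<Rightarrow> real) set" and m :: real
  assumes "sigma_finite_measure \<mu>" and "sets \<mu> = sets (restrict_space borel X)"
    and "sigma_finite_measure \<nu>" and "sets \<nu> = sets (restrict_space borel Y)"
    and "prob_density \<mu> p_tr" and "cond_density \<mu> \<nu> p_tr c_tr"
    and "prob_density \<mu> p_te" and "cond_density \<mu> \<nu> p_te c_te"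
    and "covariate_shift X Y p_tr c_tr p_te c_te"
    and "loss_fun Y loss"
    and "F \<subseteq> borel_measurable (restrict_space borel X)"
    and "\<forall>f\<in>F. \<forall>x\<in>X. \<forall>y\<in>Y. loss (f x) y \<le> m"
  shows "\<forall>f\<in>F. \<forall>g\<in>borel_measurable (restrict_space borel X).
      ereal (1 / 2 * (test_risk \<mu> \<nu> p_te c_te loss f)\<^sup>2)
        \<le> J_bound \<mu> \<nu> p_tr c_tr p_te m loss f g \<and>
      (\<forall>loss_UB.
         (\<forall>x\<in>X. 0 \<le> g x) \<and> loss_fun Y loss_UB \<and> (\<forall>t. \<forall>y\<in>Y. loss t y \<le> loss_UB t y)
         \<longrightarrow> J_bound \<mu> \<nu> p_tr c_tr p_te m loss f g
              \<le> J_bound \<mu> \<nu> p_tr c_tr p_te m loss_UB f g)"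
proof (intro ballI conjI allI impI)
  fix f and g :: "real ^ 'd \<Rightarrow> real"
  assume f: "f \<in> F" and g: "g \<in> borel_measurable (restrict_space borel X)"
  have X: "space \<mu> = X" and Y: "space \<nu> = Y"
    using sets_eq_imp_space_eq[OF assms(2)] sets_eq_imp_space_eq[OF assms(4)]
    by (simp_all add: space_restrict_space)
  have meas: "f \<in> borel_measurable \<mu>" "g \<in> borel_measurable \<mu>"
    using f g assms(11) measurable_cong_sets[OF assms(2) refl, of borel] by auto
  \<comment> \<open>Nonnegativity turns the upper bound \<open>m\<close> into the bound on the
    absolute value that \<open>half_test_risk_square_le_J_bound\<close> asks for.\<close>
  have nonneg: "\<And>t y. y \<in> Y \<Longrightarrow> 0 \<le> loss t y"
    using assms(10) by (simp add: loss_fun_def)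
  show "ereal (1 / 2 * (test_risk \<mu> \<nu> p_te c_te loss f)\<^sup>2)
      \<le> J_bound \<mu> \<nu> p_tr c_tr p_te m loss f g"
    using assms(9,12) f nonneg
    by (intro half_test_risk_square_le_J_bound assms(3,5-8) meas(2)
        measurable_loss_comp[OF assms(10,4) meas(1)]) (auto simp: X Y)
  fix loss_UB
  assume "(\<forall>x\<in>X. 0 \<le> g x) \<and> loss_fun Y loss_UB \<and> (\<forall>t. \<forall>y\<in>Y. loss t y \<le> loss_UB t y)"
  then show "J_bound \<mu> \<nu> p_tr c_tr p_te m loss f g \<le> J_bound \<mu> \<nu> p_tr c_tr p_te m loss_UB f g"
    by (intro J_bound_mono) (auto simp: X Y nonneg)
qed

end
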